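(* Let $\lambda>0$, $a\in\mathbb{R}$, $\varepsilon>0$, $T>0$, $\Delta x>0$. Let $(\bar u_i(t),\bar v_i(t))_{i\in\mathbb{Z}}$, $t\in[0,T)$, be a smooth solution of $$\begin{aligned}&\frac{d}{dt}\bar u_i=-\frac{1}{2\Delta x}(\bar v_{i+1}-\bar v_{i-1})+\frac{\lambda}{2\Delta x}(\bar u_{i+1}-2\bar u_i+\bar u_{i-1}),\\&\frac{\lambda^2}{2\Delta x}(\bar u_{i+1}-\bar u_{i-1})=a\bar u_i-\bar v_i,\end{aligned}\qquad i\in\mathbb{Z}.$$ Assume that there exists a positive constant $K<+\infty$ such that $$\Big\|\frac{d}{dt}\bar v\Big\|_{L^2(Q_T)}\le K,\qquad\|D_{xx}\bar v\|_{L^2(Q_T)}\le K .$$ Let $(u_i(t),v_i(t))_{i\in\mathbb{Z}}$, $t\in[0,T)$, be a solution of $$\begin{aligned}&\frac{d}{dt}u_i=-\frac{1}{2\Delta x}(v_{i+1}-v_{i-1})+\frac{\lambda}{2\Delta x}(u_{i+1}-2u_i+u_{i-1}),\\&\frac{d}{dt}v_i=-\frac{\lambda^2}{2\varepsilon^2\Delta x}(u_{i+1}-u_{i-1})+\frac{\lambda}{2\Delta x}(v_{i+1}-2v_i+v_{i-1})+\frac{1}{\varepsilon^2}(au_i-v_i),\end{aligned}\qquad i\in\mathbb{Z},$$ such that $\phi(0)<+\infty$, where $$\phi(t)=\sum_{i\in\mathbb{Z}}\Delta x\Big[\frac{\lambda^2}{2}(u_i-\bar u_i)^2+\frac{\varepsilon^2}{2}(v_i-\bar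 v_i)^2-\varepsilon^2a(u_i-\bar u_i)(v_i-\bar v_i)\Big](t).$$ Assume that the subcharacteristic condition $\lambda>\varepsilon|a|$ is fulfilled, and that, for constants $u_\pm,v_\pm\in\mathbb{R}$, $$\lim_{i\to\pm\infty}u_i=\lim_{i\to\pm\infty}\bar u_i=u_\pm,\qquad\lim_{i\to\pm\infty}v_i=\lim_{i\to\pm\infty}\bar v_i=v_\pm .$$ Then $$\phi(t)\le\phi(0)+B\,\varepsilon^4,\qquad t\in[0,T),$$ where $B$ is a positive constant which depends only on $\lambda$ and $K$. Moreover, if $\phi(0)\to0$ as $\varepsilon\to0$, then $\sup_{t\in[0,T)}\phi(t)\to0$ as $\varepsilon\to0$.
   Context: The real line is discretized by a uniform mesh of cells with centers $x_i=i\Delta x$, $i\in\mathbb{Z}$, and uniform step $\Delta x>0$. The unknowns of the two semi-discrete schemes (discrete in space, continuous in time) are families of real-valued functions of $t\in[0,T)$ indexed by $i\in\mathbb{Z}$. For such a family $w=(w_i(t))_{i\in\mathbb{Z}}$, $(D_{xx}w)_i=\frac{w_{i+1}-2w_i+w_{i-1}}{\Delta x^2}$, and $\|w\|_{L^2(Q_t)}=\Big(\int_0^t\sum_{i\in\mathbb{Z}}\Delta x\,|w_i(s)|^2\,ds\Big)^{1/2}$ for $0<t\le T$. Here $\varepsilon$ is the relaxation parameter, and the scheme for $(\bar u_i,\bar v_i)$ is the limit as $\varepsilon\to0$ of the scheme for $(u_i,v_i)$. *)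

theory Defs
  imports "HOL-Analysis.Analysis"
begin

text \<open>
  A grid function is a map \<open>w :: int \<Rightarrow> real \<Rightarrow> real\<close>, where \<open>w i t\<close> is the value in cell
  \<open>i\<close> at time \<open>t\<close>.  Only the values for \<open>t \<in> {0..<T}\<close> are meaningful; derivatives are
  accordingly taken within \<open>{0..<T}\<close>, hence one-sided at \<open>t = 0\<close>.
\<close>

definition Dxx :: "real \<Rightarrow> (int \<Rightarrow> real \<Rightarrow> real) \<Rightarrow> int \<Rightarrow> real \<Rightarrow> real" where
  "Dxx dx w i t = (w (i + 1) t - 2 * w i t + w (i - 1) t) / dx ^ 2"

text \<open>
  The discrete space-time norm takes values in \<open>[0, \<infinity>]\<close>, so that a bound on it includes
  the convergence of the series and of the integral.  The integral is over the open interval,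
  since for \<open>t = T\<close> the integrand is not given at \<open>T\<close>.
\<close>

definition L2Q_norm :: "real \<Rightarrow> real \<Rightarrow> (int \<Rightarrow> real \<Rightarrow> real) \<Rightarrow> ennreal" where
  "L2Q_norm dx t w =
    (let I = (\<integral>\<^sup>+ s\<in>{0<..<t}. (\<Sum>\<^sub>\<infinity>i::int. ennreal (dx * \<bar>w i s\<bar> ^ 2)) \<partial>lborel)
     in if I = \<infinity> then \<infinity> else ennreal (sqrt (enn2real I)))"

definition smooth_in_time :: "real \<Rightarrow> (real \<Rightarrow> real) \<Rightarrow> bool" where
  "smooth_in_time T f \<longleftrightarrow>
    (\<exists>D :: nat \<Rightarrow> real \<Rightarrow> real. (\<forall>t\<in>{0..<T}. D 0 t = f t) \<and>
      (\<forall>n. \<forall>t\<in>{0..<T}. (D n has_real_derivative D (Suc n) t) (at t within {0..<T})))"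

definition limit_scheme_solution ::
  "real \<Rightarrow> real \<Rightarrow> real \<Rightarrow> real \<Rightarrow> (int \<Rightarrow> real \<Rightarrow> real) \<Rightarrow> (int \<Rightarrow> real \<Rightarrow> real) \<Rightarrow> bool" where
  "limit_scheme_solution lam a dx T ub vb \<longleftrightarrow>
    (\<forall>i. \<forall>t\<in>{0..<T}.
      (ub i has_real_derivative
         - (1 / (2 * dx)) * (vb (i + 1) t - vb (i - 1) t)
         + lam / (2 * dx) * (ub (i + 1) t - 2 * ub i t + ub (i - 1) t))
        (at t within {0..<T}) \<and>
      lam ^ 2 / (2 * dx) * (ub (i + 1) t - ub (i - 1) t) = a * ub i t - vb i t)"

definition relaxation_scheme_solution ::
  "real \<Rightarrow> real \<Rightarrow> real \<Rightarrow> real \<Rightarrow> real \<Rightarrow> (int \<Rightarrow> real \<Rightarrow> real) \<Rightarrow> (int \<Rightarrow> real \<Rightarrow> real) \<Rightarrow> bool" where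
  "relaxation_scheme_solution lam a eps dx T u v \<longleftrightarrow>
    (\<forall>i. \<forall>t\<in>{0..<T}.
      (u i has_real_derivative
         - (1 / (2 * dx)) * (v (i + 1) t - v (i - 1) t)
         + lam / (2 * dx) * (u (i + 1) t - 2 * u i t + u (i - 1) t))
        (at t within {0..<T}) \<and>
      (v i has_real_derivative
         - (lam ^ 2 / (2 * eps ^ 2 * dx)) * (u (i + 1) t - u (i - 1) t)
         + lam / (2 * dx) * (v (i + 1) t - 2 * v i t + v (i - 1) t)
         + 1 / eps ^ 2 * (a * u i t - v i t))
        (at t within {0..<T}))"

definition has_far_field :: "real \<Rightarrow> (int \<Rightarrow> real \<Rightarrow> real) \<Rightarrow> real \<Rightarrow> real \<Rightarrow> bool" where
  "has_far_field T w wm wp \<longleftrightarrow>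
    (\<forall>t\<in>{0..<T}. ((\<lambda>i. w i t) \<longlongrightarrow> wm) at_bot \<and> ((\<lambda>i. w i t) \<longlongrightarrow> wp) at_top)"

text \<open>
  The relative entropy is an extended real: when \<open>lam > eps * \<bar>a\<bar>\<close> all terms are nonnegative,
  so the sum always exists in \<open>[0, \<infinity>]\<close> and is finite iff the real series converges.
\<close>

definition phi :: "real \<Rightarrow> real \<Rightarrow> real \<Rightarrow> real \<Rightarrow> (int \<Rightarrow> real \<Rightarrow> real) \<Rightarrow> (int \<Rightarrow> real \<Rightarrow> real)
    \<Rightarrow> (int \<Rightarrow> real \<Rightarrow> real) \<Rightarrow> (int \<Rightarrow> real \<Rightarrow> real) \<Rightarrow> real \<Rightarrow> ereal" where
  "phi lam a eps dx ub vb u v t =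
    (\<Sum>\<^sub>\<infinity>i::int. ereal (dx *
       (lam ^ 2 / 2 * (u i t - ub i t) ^ 2
        + eps ^ 2 / 2 * (v i t - vb i t) ^ 2
        - eps ^ 2 * a * (u i t - ub i t) * (v i t - vb i t))))"

text \<open>The hypotheses on the limit solution.  In the open interval over which
  \<^const>\<open>L2Q_norm\<close> integrates, \<^const>\<open>deriv\<close> is the time derivative.\<close>

definition admissible_limit ::
  "real \<Rightarrow> real \<Rightarrow> real \<Rightarrow> real \<Rightarrow> real \<Rightarrow> (int \<Rightarrow> real \<Rightarrow> real) \<Rightarrow> (int \<Rightarrow> real \<Rightarrow> real)
    \<Rightarrow> real \<Rightarrow> real \<Rightarrow> real \<Rightarrow> real \<Rightarrow> bool" where
  "admissible_limit lam a dx T K ub vb um up vm vp \<longleftrightarrow>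
    limit_scheme_solution lam a dx T ub vb \<and>
    (\<forall>i. smooth_in_time T (ub i) \<and> smooth_in_time T (vb i)) \<and>
    L2Q_norm dx T (\<lambda>i. deriv (vb i)) \<le> ennreal K \<and>
    L2Q_norm dx T (Dxx dx vb) \<le> ennreal K \<and>
    has_far_field T ub um up \<and> has_far_field T vb vm vp"

definition admissible_relaxation ::
  "real \<Rightarrow> real \<Rightarrow> real \<Rightarrow> real \<Rightarrow> real \<Rightarrow> (int \<Rightarrow> real \<Rightarrow> real) \<Rightarrow> (int \<Rightarrow> real \<Rightarrow> real)
    \<Rightarrow> real \<Rightarrow> real \<Rightarrow> real \<Rightarrow> real \<Rightarrow> (int \<Rightarrow> real \<Rightarrow> real) \<Rightarrow> (int \<Rightarrow> real \<Rightarrow> real) \<Rightarrow> bool" where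
  "admissible_relaxation lam a eps dx T ub vb um up vm vp u v \<longleftrightarrow>
    relaxation_scheme_solution lam a eps dx T u v \<and>
    phi lam a eps dx ub vb u v 0 < \<infinity> \<and>
    lam > eps * \<bar>a\<bar> \<and>
    has_far_field T u um up \<and> has_far_field T v vm vp"

end

theory Submission
  imports Defs
begin

text \<open>
  Write \<open>p = u - ub\<close>, \<open>q = v - vb\<close> and \<open>h = 1 / (2 dx)\<close>.  The limit solution satisfies the
  second equation of the relaxation scheme up to the residual
  \<open>r = lam h (vb\<^bsub>i+1\<^esub> - 2 vb\<^sub>i + vb\<^bsub>i-1\<^esub>) - vb\<^sub>i'\<close>, so \<open>(p, q)\<close> solves the relaxation scheme with
  source \<open>r\<close>.  Differentiating the quadratic entropy of \<open>(p, q)\<close> gives a discrete divergence, a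
  numerical dissipation that is nonpositive because the entropy is positive definite under
  the subcharacteristic condition, and \<open>- (q - a p)\<^sup>2 + eps\<^sup>2 r (q - a p) \<le> eps\<^sup>4 r\<^sup>2 / 4\<close>
  (\<open>entropy_production\<close>).  Hence the total entropy grows by at most \<open>eps\<^sup>4 / 4\<close> times the
  squared space-time norm of \<open>r\<close>.

  The residual is controlled by the time derivative of \<open>vb\<close>, with constant one.  The
  flux \<open>vb\<close> is the image of \<open>ub\<close> under a difference operator with constant coefficients, hence
  it obeys the limit equation as well: \<open>vb'\<close> is the sum of an advection term, a term from the
  relaxed flux and the viscous term \<open>lam h (vb\<^bsub>i+1\<^esub> - 2 vb\<^sub>i + vb\<^bsub>i-1\<^esub>)\<close>.  Against the viscous term, the
  advection term sums to a discrete divergence and the relaxed flux to something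
  nonnegative up to a divergence.  So \<open>r\<^sup>2 \<le> vb'\<^sup>2\<close> up to a divergence
  (\<open>residual_square_le\<close>), and \<open>B = K\<^sup>2 / 4\<close> works uniformly in \<open>a\<close>, \<open>dx\<close> and \<open>T\<close>.

  It remains to justify that the divergences integrate to nothing.  For each fixed time the
  fluxes vanish at spatial infinity, but this convergence is not assumed to be uniform in
  time, and without a bound locally uniform in time one could not pass to the limit under
  the time integral.  This bound is automatic: each scheme is an ordinary differential
  equation for a sequence, with a right-hand side controlled by the supremum norm of the
  sequence, and a solution that is bounded in space at every single time is bounded on
  compact time intervals (\<open>uniformly_bounded\<close>).  The proof is a Baire category argument: the
  bad times form a closed set, some relatively open part of which has a common bound, and
  short-time propagation spreads this bound to a full neighbourhood.  Dominated
  convergence then removes the fluxes (\<open>infsum_le_of_local_balance\<close>).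
\<close>

section \<open>Uniformly bounded families\<close>

definition uniformly_bounded_family :: "real set \<Rightarrow> ('i \<Rightarrow> real \<Rightarrow> real) \<Rightarrow> bool" where
  "uniformly_bounded_family S w \<longleftrightarrow> (\<exists>N. \<forall>t\<in>S. \<forall>i. \<bar>w i t\<bar> \<le> N)"

lemma uniformly_bounded_family_const: "uniformly_bounded_family S (\<lambda>i t. c)"
  unfolding uniformly_bounded_family_def by (intro exI[of _ "\<bar>c\<bar>"]) simp

lemma uniformly_bounded_family_add:
  assumes "uniformly_bounded_family S w" "uniformly_bounded_family S z"
  shows "uniformly_bounded_family S (\<lambda>i t. w i t + z i t)"
proof -
  obtain M N where "\<forall>t\<in>S. \<forall>i. \<bar>w i t\<bar> \<le> M" "\<forall>t\<in>S. \<forall>i. \<bar>z i t\<bar> \<le> N"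
    using assms unfolding uniformly_bounded_family_def by fast
  then have "\<forall>t\<in>S. \<forall>i. \<bar>w i t + z i t\<bar> \<le> M + N"
    by (meson abs_triangle_ineq add_mono order_trans)
  then show ?thesis
    unfolding uniformly_bounded_family_def by blast
qed

lemma uniformly_bounded_family_mult:
  assumes "uniformly_bounded_family S w" "uniformly_bounded_family S z"
  shows "uniformly_bounded_family S (\<lambda>i t. w i t * z i t)"
proof -
  obtain M N where "\<forall>t\<in>S. \<forall>i. \<bar>w i t\<bar> \<le> M" "\<forall>t\<in>S. \<forall>i. \<bar>z i t\<bar> \<le> N"
    using assms unfolding uniformly_bounded_family_def by fast
  then have "\<forall>t\<in>S. \<forall>i. \<bar>w i t * z i t\<bar> \<le> M * N"
    by (simp add: abs_mult abs_ge_zero mult_mono')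
  then show ?thesis
    unfolding uniformly_bounded_family_def by blast
qed

lemma uniformly_bounded_family_minus:
  "uniformly_bounded_family S w \<Longrightarrow> uniformly_bounded_family S (\<lambda>i t. - w i t)"
  unfolding uniformly_bounded_family_def by simp

lemma uniformly_bounded_family_diff:
  assumes "uniformly_bounded_family S w" "uniformly_bounded_family S z"
  shows "uniformly_bounded_family S (\<lambda>i t. w i t - z i t)"
  using uniformly_bounded_family_add[OF assms(1) uniformly_bounded_family_minus[OF assms(2)]]
  by simp

lemma uniformly_bounded_family_square:
  "uniformly_bounded_family S w \<Longrightarrow> uniformly_bounded_family S (\<lambda>i t. (w i t)^2)"
  using uniformly_bounded_family_mult[of S w w] by (simp add: power2_eq_square)

lemmas uniformly_bounded_family_intros =
  uniformly_bounded_family_const uniformly_bounded_family_add uniformly_bounded_family_mult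
  uniformly_bounded_family_minus uniformly_bounded_family_diff uniformly_bounded_family_square

lemma uniformly_bounded_family_reindex:
  "uniformly_bounded_family S w \<Longrightarrow> uniformly_bounded_family S (\<lambda>i. w (k i))"
  unfolding uniformly_bounded_family_def by blast

section \<open>Families whose rate of change is controlled by their supremum\<close>

text \<open>
  An infinite system of differential equations whose right-hand side is bounded for the
  supremum norm, seen through one solution.  The solution is only assumed to be bounded in
  the index at each time, with no uniformity in time.
\<close>

locale sup_controlled_family =
  fixes f f' :: "'i \<Rightarrow> real \<Rightarrow> real" and a b C :: real
  assumes C_pos: "C > 0"
    and deriv: "\<And>i t. t \<in> {a..b} \<Longrightarrow> (f i has_real_derivative f' i t) (at t within {a..b})"
    and pointwise_bounded: "\<And>t. t \<in> {a..b} \<Longrightarrow> \<exists>N. \<forall>i. \<bar>f i t\<bar> \<le> N"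
    and growth: "\<And>i t N. t \<in> {a..b} \<Longrightarrow> (\<And>j. \<bar>f j t\<bar> \<le> N) \<Longrightarrow> \<bar>f' i t\<bar> \<le> C * N"
begin

abbreviation bounded_over :: "real set \<Rightarrow> bool" where
  "bounded_over S \<equiv> uniformly_bounded_family S f"

text \<open>
  The times near which the family has a common bound; the aim is to show that every time
  is of this kind.
\<close>

definition regular_at :: "real \<Rightarrow> bool" where
  "regular_at t \<longleftrightarrow> (\<exists>d>0. bounded_over ({a..b} \<inter> ball t d))"

lemma bounded_over_subset: "bounded_over S \<Longrightarrow> R \<subseteq> S \<Longrightarrow> bounded_over R"
  unfolding uniformly_bounded_family_def by blast

lemma bounded_over_Un:
  assumes "bounded_over R" "bounded_over S"
  shows "bounded_over (R \<union> S)"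
proof -
  obtain M N where "\<forall>t\<in>R. \<forall>i. \<bar>f i t\<bar> \<le> M" "\<forall>t\<in>S. \<forall>i. \<bar>f i t\<bar> \<le> N"
    using assms unfolding uniformly_bounded_family_def by blast
  then have "\<forall>t\<in>R \<union> S. \<forall>i. \<bar>f i t\<bar> \<le> max M N"
    by (auto simp: le_max_iff_disj)
  then show ?thesis
    unfolding uniformly_bounded_family_def by blast
qed

lemma continuous_on_member: "continuous_on {a..b} (f i)"
  by (rule DERIV_continuous_on[OF deriv])

text \<open>
  On an interval of length at most \<open>1 / (2 C)\<close> a family with supremum \<open>S\<close> moves by at most
  \<open>S / 2\<close>, so \<open>S \<le> N + S / 2\<close> for any bound \<open>N\<close> at one time of the interval.  The point is that
  the resulting bound \<open>2 N\<close> no longer refers to \<open>S\<close>, whose finiteness alone is assumed.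
\<close>

lemma doubling_bound:
  assumes sub: "{s..t} \<subseteq> {a..b}" and short: "C * (t - s) \<le> 1 / 2"
    and bdd: "bounded_over {s..t}" and r: "r \<in> {s..t}" and N: "\<And>i. \<bar>f i r\<bar> \<le> N"
    and x: "x \<in> {s..t}"
  shows "\<bar>f i x\<bar> \<le> 2 * N"
proof -
  define V where "V = {\<bar>f j y\<bar> | j y. y \<in> {s..t}}"
  define S where "S = Sup V"
  have "bdd_above V"
    using bdd unfolding uniformly_bounded_family_def V_def bdd_above_def by fast
  then have le_S: "\<bar>f j y\<bar> \<le> S" if "y \<in> {s..t}" for j y
    unfolding S_def V_def using that by (auto intro!: cSup_upper)
  have S0: "0 \<le> S"
    using le_S[OF x, of i] by linarith
  have step: "\<bar>f j y\<bar> \<le> N + S / 2" if y: "y \<in> {s..t}" for j y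
  proof -
    have "norm (f j y - f j r) \<le> C * S * norm (y - r)"
    proof (rule field_differentiable_bound[where S = "{s..t}" and f' = "f' j"])
      show "(f j has_field_derivative f' j z) (at z within {s..t})" if "z \<in> {s..t}" for z
        using deriv[of z j] that sub by (meson DERIV_subset subsetD)
      show "norm (f' j z) \<le> C * S" if "z \<in> {s..t}" for z
        using growth[of z S j] that sub le_S by auto
    qed (use y r in auto)
    also have "\<dots> \<le> C * S * (t - s)"
      using y r C_pos S0 by (intro mult_left_mono) auto
    also have "\<dots> = S * (C * (t - s))"
      by simp
    also have "\<dots> \<le> S * (1 / 2)"
      using short S0 by (rule mult_left_mono)
    finally show ?thesis
      using N[of j] abs_triangle_ineq2[of "f j y" "f j r"] by simp
  qed
  have "Sup V \<le> N + S / 2"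
  proof (rule cSup_least)
    show "V \<noteq> {}"
      unfolding V_def using x by blast
  qed (use step in \<open>auto simp: V_def\<close>)
  then have "S \<le> N + S / 2"
    by (simp only: S_def)
  then show ?thesis
    using le_S[OF x, of i] by linarith
qed

lemma bounded_over_regular_interval:
  assumes sub: "{s..t} \<subseteq> {a..b}" and reg: "\<And>x. x \<in> {s..t} \<Longrightarrow> regular_at x"
  shows "bounded_over {s..t}"
proof (cases "s \<le> t")
  case True
  then have "{s..t} \<subseteq> {a..b} \<longrightarrow> bounded_over {s..t}"
  proof (induction rule: Bolzano)
    case (trans a' b' c')
    then show ?case
      using bounded_over_Un[of "{a'..b'}" "{b'..c'}"] ivl_disj_un_two_touch(4)[of a' b' c'] by simp
  next
    case (local x)
    then obtain d where d: "d > 0" "bounded_over ({a..b} \<inter> ball x d)"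
      using reg[of x] unfolding regular_at_def by auto
    show ?case
    proof (intro exI[of _ d] conjI allI impI)
      fix p q assume pq: "p \<le> x \<and> x \<le> q \<and> q - p < d" "{p..q} \<subseteq> {a..b}"
      then have "{p..q} \<subseteq> {a..b} \<inter> ball x d"
        by (auto simp: dist_real_def)
      with d(2) show "bounded_over {p..q}"
        by (rule bounded_over_subset)
    qed (use d in auto)
  qed
  then show ?thesis
    using sub by blast
qed (simp add: uniformly_bounded_family_def)

text \<open>
  The end points may be irregular: on every compact interval inside, the bound is twice that
  of the midpoint, and it reaches the end points by continuity of each member.
\<close>

lemma bounded_over_short_interval:
  assumes st: "s < t" and sub: "{s..t} \<subseteq> {a..b}" and short: "C * (t - s) \<le> 1 / 2"
    and reg: "\<And>x. x \<in> {s<..<t} \<Longrightarrow> regular_at x"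
  shows "bounded_over {s..t}"
proof -
  define m where "m = (s + t) / 2"
  have m: "m \<in> {s<..<t}"
    using st by (simp add: m_def)
  then obtain N where N: "\<And>i. \<bar>f i m\<bar> \<le> N"
    using pointwise_bounded[of m] sub by (auto simp: subset_iff)
  have inner: "\<bar>f i x\<bar> \<le> 2 * N" if x: "x \<in> {s<..<t}" for i x
  proof (rule doubling_bound)
    have "{min m x..max m x} \<subseteq> {s..t}"
      using m x by auto
    then show sub': "{min m x..max m x} \<subseteq> {a..b}"
      using sub by blast
    have "max m x - min m x \<le> t - s"
      using m x by auto
    then have "C * (max m x - min m x) \<le> C * (t - s)"
      using C_pos by (intro mult_left_mono) auto
    then show "C * (max m x - min m x) \<le> 1 / 2"
      using short by linarith
    show "bounded_over {min m x..max m x}"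
      using m x by (intro bounded_over_regular_interval sub' reg) auto
    show "\<bar>f i m\<bar> \<le> N" for i
      by (rule N)
  qed auto
  have "\<bar>f i x\<bar> \<le> 2 * N" if x: "x \<in> {s..t}" for i x
  proof (rule continuous_le_on_closure[where S = "{s<..<t}" and f = "\<lambda>x. \<bar>f i x\<bar>"])
    show "continuous_on (closure {s<..<t}) (\<lambda>x. \<bar>f i x\<bar>)"
      using st sub by (auto intro!: continuous_intros continuous_on_subset[OF continuous_on_member])
    show "x \<in> closure {s<..<t}"
      using x st by simp
  qed (use inner in auto)
  then show ?thesis
    unfolding uniformly_bounded_family_def by blast
qed

text \<open>
  This is how a bound at an irregular time \<open>c\<close> spreads through a short interval of regular
  times next to it.
\<close>

lemma bounded_near_regular_point:
  assumes c: "c \<in> {a..b}" and x: "x \<in> {a..b}" and Nc: "\<And>i. \<bar>f i c\<bar> \<le> N"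
    and short: "C * \<bar>x - c\<bar> \<le> 1 / 2"
    and reg: "\<And>y. min x c < y \<Longrightarrow> y < max x c \<Longrightarrow> regular_at y"
  shows "\<bar>f i x\<bar> \<le> 2 * N"
proof (cases "x = c")
  case True
  then show ?thesis
    using Nc[of i] by simp
next
  case False
  have sub: "{min x c..max x c} \<subseteq> {a..b}"
    using c x by simp
  have len: "max x c - min x c = \<bar>x - c\<bar>"
    by linarith
  have short': "C * (max x c - min x c) \<le> 1 / 2"
    using short unfolding len .
  have "bounded_over {min x c..max x c}"
    using False by (intro bounded_over_short_interval sub short' reg) simp_all
  from doubling_bound[OF sub short' this _ Nc] show ?thesis
    by simp
qed

lemma open_regular: "open {t. regular_at t}"
proof (rule openI)
  fix t assume "t \<in> {t. regular_at t}"
  then obtain d where d: "d > 0" "bounded_over ({a..b} \<inter> ball t d)"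
    unfolding regular_at_def by auto
  have "regular_at y" if y: "y \<in> ball t (d / 2)" for y
  proof -
    have "ball y (d / 2) \<subseteq> ball t d"
    proof
      fix z assume "z \<in> ball y (d / 2)"
      then show "z \<in> ball t d"
        using y dist_triangle[of t z y] by simp
    qed
    then have "bounded_over ({a..b} \<inter> ball y (d / 2))"
      by (intro bounded_over_subset[OF d(2)] Int_mono order_refl)
    then show ?thesis
      unfolding regular_at_def using d(1) half_gt_zero[of d] by blast
  qed
  then show "\<exists>e>0. ball t e \<subseteq> {t. regular_at t}"
    using d(1) by (intro exI[of _ "d / 2"]) auto
qed

lemma closed_sublevel: "closed {t \<in> {a..b}. \<forall>i. \<bar>f i t\<bar> \<le> N}"
proof -
  have "closed {t \<in> {a..b}. \<bar>f i t\<bar> \<le> N}" for i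
    by (rule continuous_on_closed_Collect_le)
       (use continuous_on_member[of i] in \<open>simp_all add: continuous_on_rabs\<close>)
  then have "closed ({a..b} \<inter> (\<Inter>i. {t \<in> {a..b}. \<bar>f i t\<bar> \<le> N}))"
    by (intro closed_Int closed_INT ballI) simp_all
  also have "{a..b} \<inter> (\<Inter>i. {t \<in> {a..b}. \<bar>f i t\<bar> \<le> N}) = {t \<in> {a..b}. \<forall>i. \<bar>f i t\<bar> \<le> N}"
    by blast
  finally show ?thesis .
qed

text \<open>
  Baire category: the sublevel sets of the supremum are closed and, by pointwise boundedness,
  they cover \<open>B\<close>, so one of them contains a relatively open part of \<open>B\<close>.
\<close>

lemma uniformly_bounded_on_portion:
  assumes "closed B" "B \<subseteq> {a..b}" "B \<noteq> {}"
  shows "\<exists>t\<in>B. \<exists>e>0. \<exists>N. \<forall>c\<in>B \<inter> ball t e. \<forall>i. \<bar>f i c\<bar> \<le> N"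
proof -
  define L where "L n = {t \<in> {a..b}. \<forall>i. \<bar>f i t\<bar> \<le> real n}" for n :: nat
  have closed_L: "closed (L n)" for n
    unfolding L_def by (rule closed_sublevel)
  have cover: "\<exists>n. t \<in> L n" if t: "t \<in> B" for t
  proof -
    have ab: "t \<in> {a..b}"
      using t assms(2) by blast
    obtain N where N: "\<forall>i. \<bar>f i t\<bar> \<le> N"
      using pointwise_bounded[OF ab] by blast
    obtain n :: nat where n: "N \<le> real n"
      using real_arch_simple by blast
    have "\<bar>f i t\<bar> \<le> real n" for i
      using order_trans[OF spec[OF N] n] .
    then show ?thesis
      using ab unfolding L_def by blast
  qed
  have "\<exists>n. \<not> B \<subseteq> closure (B \<inter> - L n)"
  proof (rule ccontr)
    assume "\<nexists>n. \<not> B \<subseteq> closure (B \<inter> - L n)"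
    then have dense: "B \<subseteq> closure (B \<inter> - L n)" for n
      by blast
    have "openin (top_of_set B) (B \<inter> - L n)" for n
      by (intro openin_open_Int open_Compl closed_L)
    with dense have "openin (top_of_set B) R \<and> B \<subseteq> closure R"
      if "R \<in> range (\<lambda>n. B \<inter> - L n)" for R
      using that by blast
    then have "B \<subseteq> closure (\<Inter>(range (\<lambda>n. B \<inter> - L n)))"
      by (intro Baire assms(1)) simp_all
    also have "\<Inter>(range (\<lambda>n. B \<inter> - L n)) = {}"
      using cover by blast
    finally show False
      using assms(3) by simp
  qed
  then obtain n t where t: "t \<in> B" "t \<in> - closure (B \<inter> - L n)"
    by blast
  then obtain e where e: "e > 0" "ball t e \<subseteq> - closure (B \<inter> - L n)"
    using openE[OF open_Compl[OF closed_closure]] by metis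
  have "\<bar>f i c\<bar> \<le> real n" if "c \<in> B \<inter> ball t e" for c i
  proof -
    have "c \<notin> B \<inter> - L n"
      using that e(2) closure_subset[of "B \<inter> - L n"] by blast
    then show ?thesis
      using that unfolding L_def by blast
  qed
  then show ?thesis
    using t(1) e(1) by blast
qed

lemma nearest_irregular_point:
  assumes t: "t \<in> {a..b}" "\<not> regular_at t" and x: "x \<in> {a..b}"
  obtains c where "c \<in> {a..b}" "\<not> regular_at c" "min x t \<le> c" "c \<le> max x t"
    "\<And>y. min x c < y \<Longrightarrow> y < max x c \<Longrightarrow> regular_at y"
proof -
  define D where "D = {min x t..max x t} \<inter> - {t. regular_at t}"
  have "closed D"
    unfolding D_def using open_regular by (intro closed_Int closed_Compl) simp_all
  moreover have "t \<in> D"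
    unfolding D_def using t by simp
  ultimately obtain c where c: "c \<in> D" "\<And>y. y \<in> D \<Longrightarrow> dist x c \<le> dist x y"
    using distance_attains_inf[of D x] by blast
  have cx: "min x t \<le> c" "c \<le> max x t" "\<not> regular_at c"
    using c(1) unfolding D_def by simp_all
  show ?thesis
  proof (rule that)
    show "c \<in> {a..b}"
      using cx(1,2) t(1) x by auto
    fix y assume y: "min x c < y" "y < max x c"
    show "regular_at y"
    proof (rule ccontr)
      assume "\<not> regular_at y"
      moreover have "min x t \<le> y" "y \<le> max x t"
        using y cx(1,2) by linarith+
      ultimately have "y \<in> D"
        unfolding D_def by simp
      from c(2)[OF this] show False
        using y by (simp add: dist_real_def)
    qed
  qed (use cx in simp_all)
qed

text \<open>
  If irregular times existed, some neighbourhood of one of them would carry a common bound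
  for all irregular times in it.  Every other time there is joined to its nearest irregular
  time by a short interval of regular times, so it inherits twice that bound, and the whole
  neighbourhood would be regular.
\<close>

theorem uniformly_bounded: "uniformly_bounded_family {a..b} f"
proof -
  define B where "B = {a..b} \<inter> - {t. regular_at t}"
  have closed_B: "closed B"
    unfolding B_def using open_regular by (intro closed_Int closed_Compl) simp_all
  have "B = {}"
  proof (rule ccontr)
    assume "B \<noteq> {}"
    then obtain t e N where t: "t \<in> B" and e: "e > 0"
        and N: "\<And>c i. c \<in> B \<Longrightarrow> c \<in> ball t e \<Longrightarrow> \<bar>f i c\<bar> \<le> N"
      using uniformly_bounded_on_portion[OF closed_B] unfolding B_def by blast
    have t': "t \<in> {a..b}" "\<not> regular_at t"
      using t unfolding B_def by simp_all
    \<comment> \<open>Small enough to stay in the portion and to be a short interval for the propagation.\<close>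
    define d where "d = min e (1 / (2 * C))"
    have d: "d > 0" "d \<le> e" "C * d \<le> 1 / 2"
      using e C_pos by (simp_all add: d_def min_def field_simps)
    have "\<bar>f i x\<bar> \<le> 2 * N" if x: "x \<in> {a..b}" "x \<in> ball t d" for i x
    proof -
      have xt: "\<bar>x - t\<bar> < d"
        using x(2) by (simp add: dist_real_def abs_minus_commute)
      obtain c where c: "c \<in> {a..b}" "\<not> regular_at c" "min x t \<le> c" "c \<le> max x t"
          "\<And>y. min x c < y \<Longrightarrow> y < max x c \<Longrightarrow> regular_at y"
        using nearest_irregular_point[OF t' x(1)] by blast
      have close: "\<bar>x - c\<bar> \<le> d" "\<bar>c - t\<bar> < e"
        using c(3,4) xt d(2) by linarith+
      show ?thesis
      proof (rule bounded_near_regular_point[OF c(1) x(1) _ _ c(5)])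
        show "\<bar>f j c\<bar> \<le> N" for j
          using c(1,2) close(2) unfolding B_def
          by (intro N) (simp_all add: B_def dist_real_def abs_minus_commute)
        have "C * \<bar>x - c\<bar> \<le> C * d"
          using close(1) C_pos by (intro mult_left_mono) simp_all
        then show "C * \<bar>x - c\<bar> \<le> 1 / 2"
          using d(3) by linarith
      qed simp_all
    qed
    then have "regular_at t"
      unfolding regular_at_def uniformly_bounded_family_def using d(1) by blast
    then show False
      using t'(2) by simp
  qed
  then show ?thesis
    unfolding B_def by (intro bounded_over_regular_interval) auto
qed

end

section \<open>Local balance laws on the integers\<close>

lemma bounded_if_convergent_both_ends:
  fixes w :: "int \<Rightarrow> real"
  assumes bot: "(w \<longlongrightarrow> l) at_bot" and top: "(w \<longlongrightarrow> r) at_top"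
  shows "\<exists>N. \<forall>i. \<bar>w i\<bar> \<le> N"
proof -
  obtain m where m: "\<And>i. i \<le> m \<Longrightarrow> dist (w i) l < 1"
    using tendstoD[OF bot, of 1] unfolding eventually_at_bot_linorder by auto
  obtain n where n: "\<And>i. i \<ge> n \<Longrightarrow> dist (w i) r < 1"
    using tendstoD[OF top, of 1] unfolding eventually_at_top_linorder by auto
  define M where "M = (\<Sum>i\<in>{m..n}. \<bar>w i\<bar>)"
  have M: "\<bar>w i\<bar> \<le> M" if "i \<in> {m..n}" for i
    unfolding M_def using that by (intro member_le_sum) auto
  have M0: "0 \<le> M"
    unfolding M_def by (simp add: sum_nonneg)
  have "\<bar>w i\<bar> \<le> M + \<bar>l\<bar> + \<bar>r\<bar> + 1" for i
  proof -
    consider "i \<le> m" | "i \<ge> n" | "i \<in> {m..n}"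
      by (cases "i \<le> m"; cases "i \<ge> n") auto
    then show ?thesis
    proof cases
      case 1
      then show ?thesis using m[OF 1] M0 unfolding dist_real_def by linarith
    next
      case 2
      then show ?thesis using n[OF 2] M0 unfolding dist_real_def by linarith
    next
      case 3
      then show ?thesis using M[OF 3] by linarith
    qed
  qed
  then show ?thesis
    by blast
qed

lemma sum_symmetric_interval_telescope:
  fixes W :: "int \<Rightarrow> 'a::ab_group_add"
  shows "(\<Sum>i\<in>{- int n..int n}. W (i + 1) - W i) = W (int n + 1) - W (- int n)"
proof (induction n)
  case (Suc n)
  have "{- int (Suc n)..int (Suc n)} =
      insert (- int (Suc n)) (insert (int (Suc n)) {- int n..int n})"
    by auto
  then have "(\<Sum>i\<in>{- int (Suc n)..int (Suc n)}. W (i + 1) - W i) =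
      (W (- int (Suc n) + 1) - W (- int (Suc n))) + ((W (int (Suc n) + 1) - W (int (Suc n)))
        + (\<Sum>i\<in>{- int n..int n}. W (i + 1) - W i))"
    by (simp add: sum.insert_if)
  then show ?case
    using Suc.IH by (simp add: algebra_simps)
qed simp

lemma finite_int_set_subset_symmetric_interval:
  assumes "finite (F :: int set)"
  shows "\<exists>n. F \<subseteq> {- int n..int n}"
proof -
  have "F \<subseteq> {- int n..int n}" if "n = (\<Sum>i\<in>F. nat \<bar>i\<bar>)" for n
  proof
    fix i assume "i \<in> F"
    then have "nat \<bar>i\<bar> \<le> n"
      unfolding that using assms by (intro member_le_sum) auto
    then show "i \<in> {- int n..int n}"
      by auto
  qed
  then show ?thesis
    by blast
qed

lemma tendsto_int_shift:
  fixes w :: "int \<Rightarrow> real"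
  shows "(w \<longlongrightarrow> l) at_top \<Longrightarrow> ((\<lambda>i. w (i + k)) \<longlongrightarrow> l) at_top"
    and "(w \<longlongrightarrow> l) at_bot \<Longrightarrow> ((\<lambda>i. w (i + k)) \<longlongrightarrow> l) at_bot"
proof -
  have "filterlim (\<lambda>i. i + k) at_top at_top"
    unfolding filterlim_at_top eventually_at_top_linorder
  proof
    fix Z :: int
    show "\<exists>N. \<forall>n\<ge>N. Z \<le> n + k"
      by (intro exI[of _ "Z - k"]) auto
  qed
  then show "(w \<longlongrightarrow> l) at_top \<Longrightarrow> ((\<lambda>i. w (i + k)) \<longlongrightarrow> l) at_top"
    by (rule filterlim_compose[rotated])
  have "filterlim (\<lambda>i. i + k) at_bot at_bot"
    unfolding filterlim_at_bot eventually_at_bot_linorder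
  proof
    fix Z :: int
    show "\<exists>N. \<forall>n\<le>N. n + k \<le> Z"
      by (intro exI[of _ "Z - k"]) auto
  qed
  then show "(w \<longlongrightarrow> l) at_bot \<Longrightarrow> ((\<lambda>i. w (i + k)) \<longlongrightarrow> l) at_bot"
    by (rule filterlim_compose[rotated])
qed

text \<open>
  Summing the balance over \<open>-n, \<dots>, n\<close> and integrating in time leaves the source and the two
  boundary fluxes.  These tend to zero at each time and have a common bound, so their time
  integrals tend to zero by dominated convergence.  Partial sums are
  differentiated rather than the series, whose convergence at positive times is an outcome
  of the estimate.
\<close>

lemma infsum_le_of_local_balance:
  fixes e e' g W :: "int \<Rightarrow> real \<Rightarrow> real"
  assumes tau: "0 \<le> \<tau>"
    and nonneg: "\<And>i s. s \<in> {0..\<tau>} \<Longrightarrow> 0 \<le> e i s"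
    and deriv: "\<And>i s. s \<in> {0..\<tau>} \<Longrightarrow> (e i has_real_derivative e' i s) (at s within {0..\<tau>})"
    and balance: "\<And>i s. s \<in> {0..\<tau>} \<Longrightarrow> e' i s \<le> g i s + (W (i + 1) s - W i s)"
    and cont_g: "\<And>i. continuous_on {0..\<tau>} (g i)"
    and cont_W: "\<And>i. continuous_on {0..\<tau>} (W i)"
    and bounded_W: "uniformly_bounded_family {0..\<tau>} W"
    and W_top: "\<And>s. s \<in> {0..\<tau>} \<Longrightarrow> ((\<lambda>i. W i s) \<longlongrightarrow> 0) at_top"
    and W_bot: "\<And>s. s \<in> {0..\<tau>} \<Longrightarrow> ((\<lambda>i. W i s) \<longlongrightarrow> 0) at_bot"
    and source: "\<And>n. integral {0..\<tau>} (\<lambda>s. \<Sum>i\<in>{- int n..int n}. g i s) \<le> J"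
  shows "(\<Sum>\<^sub>\<infinity>i. ereal (e i \<tau>)) \<le> (\<Sum>\<^sub>\<infinity>i. ereal (e i 0)) + ereal J"
proof -
  define I where "I n = {- int n..int n}" for n
  define b where "b n s = W (int n + 1) s - W (- int n) s" for n s
  have cont_b: "continuous_on {0..\<tau>} (b n)" for n
    unfolding b_def by (intro continuous_intros cont_W)
  obtain N where N: "\<And>i s. s \<in> {0..\<tau>} \<Longrightarrow> \<bar>W i s\<bar> \<le> N"
    using bounded_W unfolding uniformly_bounded_family_def by blast
  have b_lim: "(\<lambda>n. integral {0..\<tau>} (b n)) \<longlonglongrightarrow> integral {0..\<tau>} (\<lambda>s. 0)"
  proof (rule dominated_convergence(2))
    show "b n integrable_on {0..\<tau>}" for n
      by (intro integrable_continuous_real cont_b)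
    show "(\<lambda>s. 2 * N) integrable_on {0..\<tau>}"
      by (intro integrable_continuous_real continuous_intros)
    show "norm (b n s) \<le> 2 * N" if "s \<in> {0..\<tau>}" for n s
      using N[OF that, of "int n + 1"] N[OF that, of "- int n"] unfolding b_def by simp
    show "(\<lambda>n. b n s) \<longlonglongrightarrow> 0" if s: "s \<in> {0..\<tau>}" for s
    proof -
      have "filterlim (\<lambda>n. int n + 1) at_top sequentially"
        by (intro filterlim_at_top_mono[OF filterlim_int_sequentially]) simp
      moreover have "filterlim (\<lambda>n. - int n) at_bot sequentially"
        unfolding filterlim_at_bot eventually_sequentially
      proof
        fix Z :: int
        show "\<exists>N. \<forall>n\<ge>N. - int n \<le> Z"
          by (intro exI[of _ "nat (- Z)"]) auto
      qed
      ultimately have "(\<lambda>n. W (int n + 1) s - W (- int n) s) \<longlonglongrightarrow> 0 - 0"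
        by (intro tendsto_diff filterlim_compose[OF W_top[OF s]] filterlim_compose[OF W_bot[OF s]])
      then show ?thesis
        unfolding b_def by simp
    qed
  qed
  have partial: "(\<Sum>i\<in>I n. e i \<tau>) \<le> (\<Sum>i\<in>I n. e i 0) + J + integral {0..\<tau>} (b n)" for n
  proof -
    define G where "G s = (\<Sum>i\<in>I n. g i s)" for s
    have cont_G: "continuous_on {0..\<tau>} G"
      unfolding G_def by (intro continuous_intros cont_g)
    have "((\<lambda>s. \<Sum>i\<in>I n. e' i s) has_integral (\<Sum>i\<in>I n. e i \<tau>) - (\<Sum>i\<in>I n. e i 0)) {0..\<tau>}"
      using tau deriv unfolding has_real_derivative_iff_has_vector_derivative
      by (intro fundamental_theorem_of_calculus has_vector_derivative_sum)
    moreover have "((\<lambda>s. G s + b n s) has_integral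
        (integral {0..\<tau>} G + integral {0..\<tau>} (b n))) {0..\<tau>}"
      by (intro has_integral_add integrable_integral integrable_continuous_real cont_G cont_b)
    moreover have "(\<Sum>i\<in>I n. e' i s) \<le> G s + b n s" if "s \<in> {0..\<tau>}" for s
    proof -
      have "(\<Sum>i\<in>I n. e' i s) \<le> (\<Sum>i\<in>I n. g i s + (W (i + 1) s - W i s))"
        by (intro sum_mono balance that)
      also have "\<dots> = G s + b n s"
        using sum_symmetric_interval_telescope[of "\<lambda>i. W i s" n]
        unfolding G_def b_def I_def sum.distrib by simp
      finally show ?thesis .
    qed
    ultimately have "(\<Sum>i\<in>I n. e i \<tau>) - (\<Sum>i\<in>I n. e i 0)
        \<le> integral {0..\<tau>} G + integral {0..\<tau>} (b n)"
      by (rule has_integral_le)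
    then show ?thesis
      using source[of n] unfolding G_def I_def by simp
  qed
  have endpoints: "0 \<in> {0..\<tau>}" "\<tau> \<in> {0..\<tau>}"
    using tau by simp_all
  have sup_form: "(\<Sum>\<^sub>\<infinity>i. ereal (e i s)) = (SUP F\<in>{F. finite F \<and> F \<subseteq> UNIV}. \<Sum>i\<in>F. ereal (e i s))"
    if "s \<in> {0..\<tau>}" for s
    using nonneg[OF that] by (intro nonneg_infsum_complete) simp
  have start: "ereal (\<Sum>i\<in>I n. e i 0) \<le> (\<Sum>\<^sub>\<infinity>i. ereal (e i 0))" for n
    unfolding sup_form[OF endpoints(1)] by (rule SUP_upper2[of "I n"]) (simp_all add: I_def)
  show ?thesis
  proof (cases "(\<Sum>\<^sub>\<infinity>i. ereal (e i 0))")
    case (real r)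
    have "(\<Sum>i\<in>F. ereal (e i \<tau>)) \<le> ereal (r + J)" if F: "finite F" for F
    proof -
      obtain n where n: "F \<subseteq> I n"
        unfolding I_def using finite_int_set_subset_symmetric_interval[OF F] by blast
      have "(\<Sum>i\<in>F. e i \<tau>) \<le> r + J + integral {0..\<tau>} (b m)" if "m \<ge> n" for m
      proof -
        have "I n \<subseteq> I m"
          unfolding I_def using that by auto
        then have "(\<Sum>i\<in>F. e i \<tau>) \<le> (\<Sum>i\<in>I m. e i \<tau>)"
          using n nonneg[OF endpoints(2)] by (intro sum_mono2) (auto simp: I_def)
        moreover have "(\<Sum>i\<in>I m. e i 0) \<le> r"
          using start[of m] real by simp
        ultimately show ?thesis
          using partial[of m] by linarith
      qed
      moreover have "(\<lambda>m. r + J + integral {0..\<tau>} (b m)) \<longlonglongrightarrow> r + J + integral {0..\<tau>} (\<lambda>s. 0)"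
        by (intro tendsto_intros b_lim)
      ultimately have "(\<Sum>i\<in>F. e i \<tau>) \<le> r + J + integral {0..\<tau>} (\<lambda>s. 0)"
        by (intro LIMSEQ_le_const[where a = "\<Sum>i\<in>F. e i \<tau>"]) auto
      then show ?thesis
        by simp
    qed
    then show ?thesis
      unfolding real sup_form[OF endpoints(2)] by (simp add: SUP_le_iff)
  next
    case MInf
    have "0 \<le> (\<Sum>\<^sub>\<infinity>i. ereal (e i 0))"
      using nonneg[OF endpoints(1)] by (intro infsum_nonneg) simp
    with MInf show ?thesis
      by simp
  qed simp
qed

text \<open>
  The link between the extended-valued space-time norm and ordinary integrals of finite sums,
  which are the only ones that the energy argument sees.  The family \<open>z\<close> stands for a
  continuous version of \<open>w\<close>, prescribed only at interior times.
\<close>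

lemma integral_partial_sum_le_L2Q_norm:
  assumes norm: "L2Q_norm dx T w \<le> ennreal K" and K: "0 \<le> K" and dx: "0 \<le> dx"
    and tau: "0 \<le> \<tau>" "\<tau> \<le> T"
    and cont: "\<And>i. continuous_on {0..\<tau>} (z i)"
    and eq: "\<And>i s. 0 < s \<Longrightarrow> s < \<tau> \<Longrightarrow> z i s = w i s"
    and F: "finite F"
  shows "integral {0..\<tau>} (\<lambda>s. \<Sum>i\<in>F. dx * (z i s)^2) \<le> K^2"
proof -
  define I where "I = (\<integral>\<^sup>+ s\<in>{0<..<T}. (\<Sum>\<^sub>\<infinity>i. ennreal (dx * \<bar>w i s\<bar> ^ 2)) \<partial>lborel)"
  have norm_eq: "L2Q_norm dx T w = (if I = \<infinity> then \<infinity> else ennreal (sqrt (enn2real I)))"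
    unfolding L2Q_norm_def Let_def I_def ..
  have fin: "I \<noteq> \<infinity>"
    using norm unfolding norm_eq by (auto simp: top_unique)
  then have "ennreal (sqrt (enn2real I)) \<le> ennreal K"
    using norm unfolding norm_eq by simp
  then have "sqrt (enn2real I) \<le> K"
    using K by (simp add: ennreal_le_iff)
  then have "enn2real I \<le> K^2"
    using sqrt_le_D by blast
  then have I_le: "I \<le> ennreal (K^2)"
    using fin by (metis ennreal_enn2real ennreal_leI infinity_ennreal_def less_top)
  define G where "G s = (\<Sum>i\<in>F. dx * (z i s)^2)" for s
  have G_nonneg: "0 \<le> G s" for s
    unfolding G_def using dx by (intro sum_nonneg) simp
  have "continuous_on {0..\<tau>} G"
    unfolding G_def by (intro continuous_intros cont)
  then have "(G has_integral integral {0..\<tau>} G) {0..\<tau>}"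
    by (intro integrable_integral integrable_continuous_real)
  then have "(G has_integral integral {0..\<tau>} G) {0<..<\<tau>}"
    by (simp add: has_integral_Icc_iff_Ioo)
  then have "ennreal (integral {0..\<tau>} G) = (\<integral>\<^sup>+ s\<in>{0<..<\<tau>}. ennreal (G s) \<partial>lborel)"
    by (intro nn_integral_has_integral_lebesgue'[symmetric] G_nonneg)
  also have "\<dots> \<le> I"
    unfolding I_def
  proof (rule nn_integral_mono)
    fix s :: real
    show "ennreal (G s) * indicator {0<..<\<tau>} s
        \<le> (\<Sum>\<^sub>\<infinity>i. ennreal (dx * \<bar>w i s\<bar> ^ 2)) * indicator {0<..<T} s"
    proof (cases "s \<in> {0<..<\<tau>}")
      case True
      have "ennreal (G s) = (\<Sum>i\<in>F. ennreal (dx * \<bar>w i s\<bar> ^ 2))"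
        unfolding G_def using True dx by (simp add: eq)
      also have "\<dots> \<le> (\<Sum>\<^sub>\<infinity>i. ennreal (dx * \<bar>w i s\<bar> ^ 2))"
        using F by (subst nonneg_infsum_complete) (auto intro!: SUP_upper)
      finally show ?thesis
        using True tau by simp
    qed simp
  qed
  finally have "ennreal (integral {0..\<tau>} G) \<le> ennreal (K^2)"
    using I_le by (rule order_trans)
  then show ?thesis
    unfolding G_def by (simp add: ennreal_le_iff)
qed

section \<open>Entropy production and residual\<close>

definition entropy :: "real \<Rightarrow> real \<Rightarrow> real \<Rightarrow> real \<Rightarrow> real \<Rightarrow> real" where
  "entropy lam a eps p q = lam^2 / 2 * p^2 + eps^2 / 2 * q^2 - eps^2 * a * p * q"

text \<open>
  The flux between two neighbouring cells with errors \<open>(p0, q0)\<close> and \<open>(p1, q1)\<close>: the products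
  come from the central differences, the increment of the entropy from the numerical
  viscosity.
\<close>

definition entropy_flux ::
  "real \<Rightarrow> real \<Rightarrow> real \<Rightarrow> real \<Rightarrow> real \<Rightarrow> real \<Rightarrow> real \<Rightarrow> real \<Rightarrow> real" where
  "entropy_flux h lam a eps p0 q0 p1 q1 =
     - (lam^2 * h * (p0 * q1 + q0 * p1)) + eps^2 * a * h * q0 * q1 + lam^2 * a * h * p0 * p1
     + lam * h * (entropy lam a eps p1 q1 - entropy lam a eps p0 q0)"

text \<open>
  The flux between the cells of \<open>w1\<close> and \<open>w2\<close> in the balance that compares the squared residual
  with the squared time derivative.
\<close>

definition residual_flux :: "real \<Rightarrow> real \<Rightarrow> real \<Rightarrow> real \<Rightarrow> real \<Rightarrow> real \<Rightarrow> real \<Rightarrow> real" where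
  "residual_flux h lam a w0 w1 w2 w3 =
     2 * a * lam * h^2 * (w2 - w1)^2
     + lam^3 * h^3 * ((w3 - 2 * w2 + w1)^2 - (w2 - 2 * w1 + w0)^2)"

text \<open>
  Completing the square: \<open>2 * entropy = (lam\<^sup>2 - eps\<^sup>2 a\<^sup>2) p\<^sup>2 + eps\<^sup>2 (q - a p)\<^sup>2\<close>.
\<close>

lemma entropy_nonneg:
  assumes "eps > 0" "lam > eps * \<bar>a\<bar>"
  shows "0 \<le> entropy lam a eps p q"
proof -
  have "(eps * \<bar>a\<bar>)^2 \<le> lam^2"
    using assms by (intro power_mono) auto
  then have a: "eps^2 * a^2 \<le> lam^2"
    by (simp add: power_mult_distrib)
  have "2 * entropy lam a eps p q = (lam^2 - eps^2 * a^2) * p^2 + eps^2 * (q - a * p)^2"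
    unfolding entropy_def by (simp add: power2_eq_square field_simps)
  also have "\<dots> \<ge> 0"
    using a by simp
  finally show ?thesis
    by simp
qed

lemma entropy_has_derivative:
  assumes p: "(p has_real_derivative p') (at t within S)"
    and q: "(q has_real_derivative q') (at t within S)"
  shows "((\<lambda>s. entropy lam a eps (p s) (q s)) has_real_derivative
      lam^2 * p t * p' + eps^2 * q t * q' - eps^2 * a * (p' * q t + p t * q')) (at t within S)"
proof -
  have "((\<lambda>s. lam^2 / 2 * (p s)^2 + eps^2 / 2 * (q s)^2 - eps^2 * a * (p s * q s))
      has_real_derivative lam^2 / 2 * (2 * p t * p') + eps^2 / 2 * (2 * q t * q')
        - eps^2 * a * (p' * q t + q' * p t)) (at t within S)"
    using DERIV_power[OF p, of 2] DERIV_power[OF q, of 2]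
    by (intro DERIV_diff DERIV_add DERIV_cmult DERIV_mult p q) (simp_all add: ac_simps)
  then show ?thesis
    unfolding entropy_def by (simp add: ac_simps)
qed

text \<open>
  In the exact balance the cross term \<open>- eps\<^sup>2 a p q\<close> of the entropy turns the relaxation source
  into \<open>- (q - a p)\<^sup>2\<close> and the central differences into a divergence.  The viscosity contributes
  a divergence minus the entropies of the two one-sided differences, because
  \<open>p1 (p2 - 2 p1 + p0)\<close> is half the second difference of the squares minus half the sum of the
  squared increments, and likewise for the other quadratic terms.  Young's inequality absorbs
  the residual in \<open>- (q - a p)\<^sup>2\<close>.
\<close>

lemma entropy_production:
  assumes eps: "eps > 0" and lam: "lam > eps * \<bar>a\<bar>" and h: "0 \<le> h"
    and dp: "dp = - h * (q2 - q0) + lam * h * (p2 - 2 * p1 + p0)"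
    and dq: "eps^2 * dq = - (lam^2 * h * (p2 - p0)) + eps^2 * (lam * h * (q2 - 2 * q1 + q0))
               + (a * p1 - q1) + eps^2 * r"
  shows "lam^2 * p1 * dp + eps^2 * q1 * dq - eps^2 * a * (dp * q1 + p1 * dq)
    \<le> eps^4 / 4 * r^2 + (entropy_flux h lam a eps p1 q1 p2 q2 - entropy_flux h lam a eps p0 q0 p1 q1)"
    (is "?e' \<le> _ + ?flux")
proof -
  have "?e' = lam^2 * p1 * dp + (q1 - a * p1) * (eps^2 * dq) - eps^2 * a * dp * q1"
    by algebra
  also have "\<dots> = ?flux
      - lam * h * (entropy lam a eps (p2 - p1) (q2 - q1) + entropy lam a eps (p1 - p0) (q1 - q0))
      - (q1 - a * p1)^2 + eps^2 * r * (q1 - a * p1)"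
    unfolding dq unfolding dp entropy_flux_def entropy_def
    by (simp add: field_simps power2_eq_square)
  also have "\<dots> \<le> ?flux - (q1 - a * p1)^2 + eps^2 * r * (q1 - a * p1)"
  proof -
    have "0 < lam"
      using eps lam by (smt (verit) mult_nonneg_nonneg)
    then have "0 \<le> lam * h * (entropy lam a eps (p2 - p1) (q2 - q1)
        + entropy lam a eps (p1 - p0) (q1 - q0))"
      using h entropy_nonneg[OF eps lam] by (intro mult_nonneg_nonneg add_nonneg_nonneg) auto
    then show ?thesis
      by linarith
  qed
  also have "\<dots> \<le> eps^4 / 4 * r^2 + ?flux"
  proof -
    have "0 \<le> (q1 - a * p1 - eps^2 * r / 2)^2"
      by simp
    also have "\<dots> = (q1 - a * p1)^2 - eps^2 * r * (q1 - a * p1) + eps^4 / 4 * r^2"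
      by (simp add: field_simps power2_eq_square power4_eq_xxxx)
    finally show ?thesis
      by linarith
  qed
  finally show ?thesis .
qed

text \<open>
  The algebraic constraint makes \<open>v\<close> the image of \<open>u\<close> under \<open>a - lam\<^sup>2 h \<delta>\<close> with \<open>\<delta>\<close> the central
  difference.  This operator commutes with all differences, so \<open>v\<close> obeys the limit equation too;
  eliminating \<open>u\<close> leaves an expression in \<open>v\<close> alone.
\<close>

lemma limit_scheme_flux_derivative:
  fixes u v :: "int \<Rightarrow> real"
  assumes constr: "\<And>i. lam^2 * h * (u (i + 1) - u (i - 1)) = a * u i - v i"
    and du: "\<And>i. du i = - h * (v (i + 1) - v (i - 1)) + lam * h * (u (i + 1) - 2 * u i + u (i - 1))"
  shows "a * du i - lam^2 * h * (du (i + 1) - du (i - 1))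
    = - a * h * (v (i + 1) - v (i - 1)) + lam^2 * h^2 * (v (i + 2) - 2 * v i + v (i - 2))
      + lam * h * (v (i + 1) - 2 * v i + v (i - 1))"
proof -
  have v: "v i = a * u i - lam^2 * h * (u (i + 1) - u (i - 1))" for i
    using constr[of i] by simp
  have idx: "i + 1 + 1 = i + 2" "i - 1 - 1 = i - 2" "i + 1 - 1 = i" "i - 1 + 1 = i"
    by simp_all
  show ?thesis
    unfolding du idx v[of "i + 1"] v[of "i - 1"] v[of i]
    by (simp add: field_simps power2_eq_square)
qed

text \<open>
  Write \<open>d = n + m + s\<close> with the viscous part \<open>s\<close>; the left side is \<open>(n + m)\<^sup>2 = d\<^sup>2 - s\<^sup>2 - 2 n s - 2 m s\<close>.
  The advection product \<open>n s\<close> is a difference of squared increments.  For the relaxed flux, the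
  wide second difference \<open>w4 - 2 w2 + w0\<close> equals \<open>s0 + 2 s1 + s2\<close> in terms of the second
  differences, and \<open>s1 (s0 + 2 s1 + s2)\<close> is \<open>((s0 + s1)\<^sup>2 + (s1 + s2)\<^sup>2) / 2\<close> up to a divergence.
\<close>

lemma residual_square_le:
  assumes "0 \<le> lam" "0 \<le> h"
    and d: "d = - a * h * (w3 - w1) + lam^2 * h^2 * (w4 - 2 * w2 + w0)
                + lam * h * (w3 - 2 * w2 + w1)"
  shows "(lam * h * (w3 - 2 * w2 + w1) - d)^2
    \<le> d^2 + (residual_flux h lam a w1 w2 w3 w4 - residual_flux h lam a w0 w1 w2 w3)"
proof -
  define s0 s1 s2 where s: "s0 = w2 - 2 * w1 + w0" "s1 = w3 - 2 * w2 + w1" "s2 = w4 - 2 * w3 + w2"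
  have "(lam * h * (w3 - 2 * w2 + w1) - d)^2 + (lam * h * s1)^2 + lam^3 * h^3 * ((s1 + s2)^2 + (s0 + s1)^2)
    = d^2 + (residual_flux h lam a w1 w2 w3 w4 - residual_flux h lam a w0 w1 w2 w3)"
    unfolding d residual_flux_def s by algebra
  moreover have "0 \<le> (lam * h * s1)^2 + lam^3 * h^3 * ((s1 + s2)^2 + (s0 + s1)^2)"
    using assms(1,2) by simp
  ultimately show ?thesis
    by linarith
qed

lemma entropy_flux_tendsto_0:
  assumes "(p0 \<longlongrightarrow> 0) F" "(q0 \<longlongrightarrow> 0) F" "(p1 \<longlongrightarrow> 0) F" "(q1 \<longlongrightarrow> 0) F"
  shows "((\<lambda>i. entropy_flux h lam a eps (p0 i) (q0 i) (p1 i) (q1 i)) \<longlongrightarrow> 0) F"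
  unfolding entropy_flux_def entropy_def by (rule tendsto_eq_intros assms refl | simp)+

lemma residual_flux_tendsto_0:
  assumes "(w0 \<longlongrightarrow> l) F" "(w1 \<longlongrightarrow> l) F" "(w2 \<longlongrightarrow> l) F" "(w3 \<longlongrightarrow> l) F"
  shows "((\<lambda>i. residual_flux h lam a (w0 i) (w1 i) (w2 i) (w3 i)) \<longlongrightarrow> 0) F"
  unfolding residual_flux_def by (rule tendsto_eq_intros assms refl | simp)+

section \<open>The two schemes\<close>

lemma limit_schemeD:
  assumes "limit_scheme_solution lam a dx T ub vb" "t \<in> {0..<T}" and h: "h = 1 / (2 * dx)"
  shows "(ub i has_real_derivative
      - h * (vb (i + 1) t - vb (i - 1) t) + lam * h * (ub (i + 1) t - 2 * ub i t + ub (i - 1) t))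
      (at t within {0..<T})"
    and "lam^2 * h * (ub (i + 1) t - ub (i - 1) t) = a * ub i t - vb i t"
  using assms(1,2) unfolding limit_scheme_solution_def h by simp_all

lemma relaxation_schemeD:
  assumes "relaxation_scheme_solution lam a eps dx T u v" "t \<in> {0..<T}" and h: "h = 1 / (2 * dx)"
  shows "(u i has_real_derivative
      - h * (v (i + 1) t - v (i - 1) t) + lam * h * (u (i + 1) t - 2 * u i t + u (i - 1) t))
      (at t within {0..<T})"
    and "(v i has_real_derivative
      - (lam^2 * h / eps^2 * (u (i + 1) t - u (i - 1) t))
      + lam * h * (v (i + 1) t - 2 * v i t + v (i - 1) t) + 1 / eps^2 * (a * u i t - v i t))
      (at t within {0..<T})"
proof -
  have coeffs: "1 / (2 * dx) = h" "lam / (2 * dx) = lam * h"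
      "lam^2 / (2 * eps^2 * dx) = lam^2 * h / eps^2"
    unfolding h by simp_all
  show "(u i has_real_derivative
      - h * (v (i + 1) t - v (i - 1) t) + lam * h * (u (i + 1) t - 2 * u i t + u (i - 1) t))
      (at t within {0..<T})"
    and "(v i has_real_derivative
      - (lam^2 * h / eps^2 * (u (i + 1) t - u (i - 1) t))
      + lam * h * (v (i + 1) t - 2 * v i t + v (i - 1) t) + 1 / eps^2 * (a * u i t - v i t))
      (at t within {0..<T})"
    using assms(1,2) unfolding relaxation_scheme_solution_def coeffs
    by (simp_all only: minus_mult_left)
qed

lemma far_field_limits:
  assumes "has_far_field T w wm wp" "t \<in> {0..<T}"
  shows "((\<lambda>i. w i t) \<longlongrightarrow> wm) at_bot" "((\<lambda>i. w i t) \<longlongrightarrow> wp) at_top"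
  using assms unfolding has_far_field_def by simp_all

lemma far_field_pointwise_bounded:
  "has_far_field T w wm wp \<Longrightarrow> t \<in> {0..<T} \<Longrightarrow> \<exists>N. \<forall>i. \<bar>w i t\<bar> \<le> N"
  by (rule bounded_if_convergent_both_ends) (rule far_field_limits; assumption)+

lemma abs_second_difference_le:
  fixes x y z N :: real
  assumes "\<bar>x\<bar> \<le> N" "\<bar>y\<bar> \<le> N" "\<bar>z\<bar> \<le> N"
  shows "\<bar>x - 2 * y + z\<bar> \<le> 4 * N"
  using assms by linarith

lemma abs_mult_le:
  fixes c x N :: real
  assumes "\<bar>x\<bar> \<le> N"
  shows "\<bar>c * x\<bar> \<le> \<bar>c\<bar> * N"
  using assms by (simp add: abs_mult mult_left_mono)

text \<open>
  The constraint expresses \<open>vb\<close> by \<open>ub\<close>, so the limit scheme is a closed system for \<open>ub\<close> whose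
  right-hand side is bounded for the supremum norm.
\<close>

lemma limit_scheme_uniformly_bounded:
  assumes sol: "limit_scheme_solution lam a dx T ub vb" and far: "has_far_field T ub um up"
    and tau: "\<tau> < T"
  shows "uniformly_bounded_family {0..\<tau>} ub"
proof -
  define h where "h = 1 / (2 * dx)"
  define ub' where "ub' i t = - h * (vb (i + 1) t - vb (i - 1) t)
    + lam * h * (ub (i + 1) t - 2 * ub i t + ub (i - 1) t)" for i t
  define A where "A = \<bar>a\<bar> + \<bar>lam^2 * h\<bar> * 2"
  have sub: "{0..\<tau>} \<subseteq> {0..<T}"
    using tau by auto
  \<comment> \<open>The summand 1 keeps the constant positive when all coefficients vanish.\<close>
  interpret sup_controlled_family ub ub' 0 \<tau> "\<bar>h\<bar> * (2 * A) + \<bar>lam * h\<bar> * 4 + 1"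
  proof
    show "0 < \<bar>h\<bar> * (2 * A) + \<bar>lam * h\<bar> * 4 + 1"
      unfolding A_def by (intro add_nonneg_pos add_nonneg_nonneg mult_nonneg_nonneg) auto
    fix t assume "t \<in> {0..\<tau>}"
    then have t: "t \<in> {0..<T}"
      using sub by blast
    show "(ub i has_real_derivative ub' i t) (at t within {0..\<tau>})" for i
      using limit_schemeD(1)[OF sol t h_def] sub unfolding ub'_def by (rule DERIV_subset)
    show "\<exists>N. \<forall>i. \<bar>ub i t\<bar> \<le> N"
      by (rule far_field_pointwise_bounded[OF far t])
    fix i N assume N: "\<bar>ub j t\<bar> \<le> N" for j
    have vb: "\<bar>vb j t\<bar> \<le> A * N" for j
    proof -
      have "vb j t = a * ub j t - lam^2 * h * (ub (j + 1) t - ub (j - 1) t)"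
        using limit_schemeD(2)[OF sol t h_def, of j] by simp
      moreover have "\<bar>a * ub j t\<bar> \<le> \<bar>a\<bar> * N"
        by (rule abs_mult_le[OF N])
      moreover have "\<bar>lam^2 * h * (ub (j + 1) t - ub (j - 1) t)\<bar> \<le> \<bar>lam^2 * h\<bar> * (2 * N)"
        using N[of "j + 1"] N[of "j - 1"] by (intro abs_mult_le) linarith
      ultimately show ?thesis
        unfolding A_def by (simp add: algebra_simps)
    qed
    have "\<bar>- h * (vb (i + 1) t - vb (i - 1) t)\<bar> \<le> \<bar>- h\<bar> * (2 * (A * N))"
      using vb[of "i + 1"] vb[of "i - 1"] by (intro abs_mult_le) linarith
    moreover have "\<bar>lam * h * (ub (i + 1) t - 2 * ub i t + ub (i - 1) t)\<bar> \<le> \<bar>lam * h\<bar> * (4 * N)"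
      by (intro abs_mult_le abs_second_difference_le N)
    moreover have "0 \<le> N"
      using N[of 0] by linarith
    ultimately show "\<bar>ub' i t\<bar> \<le> (\<bar>h\<bar> * (2 * A) + \<bar>lam * h\<bar> * 4 + 1) * N"
      unfolding ub'_def by (simp add: algebra_simps)
  qed
  show ?thesis
    by (rule uniformly_bounded)
qed

text \<open>
  The two unknowns are coupled, so they enter as one family, indexed by a flag and the cell.
\<close>

lemma relaxation_scheme_uniformly_bounded:
  assumes sol: "relaxation_scheme_solution lam a eps dx T u v"
    and far: "has_far_field T u um up" "has_far_field T v vm vp"
    and tau: "\<tau> < T"
  shows "uniformly_bounded_family {0..\<tau>} u" "uniformly_bounded_family {0..\<tau>} v"
proof -
  define h where "h = 1 / (2 * dx)"
  define w where "w k = (if fst k then u (snd k) else v (snd k))" for k :: "bool \<times> int"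
  define u' where "u' i t = - h * (v (i + 1) t - v (i - 1) t)
    + lam * h * (u (i + 1) t - 2 * u i t + u (i - 1) t)" for i t
  define v' where "v' i t = - (lam^2 * h / eps^2 * (u (i + 1) t - u (i - 1) t))
    + lam * h * (v (i + 1) t - 2 * v i t + v (i - 1) t) + 1 / eps^2 * (a * u i t - v i t)" for i t
  define w' where "w' k = (if fst k then u' (snd k) else v' (snd k))" for k :: "bool \<times> int"
  define C where "C = \<bar>h\<bar> * 2 + \<bar>lam^2 * h / eps^2\<bar> * 2 + \<bar>lam * h\<bar> * 4
    + \<bar>1 / eps^2\<bar> * (\<bar>a\<bar> + 1) + 1"
  have sub: "{0..\<tau>} \<subseteq> {0..<T}"
    using tau by auto
  interpret sup_controlled_family w w' 0 \<tau> C
  proof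
    show "0 < C"
      unfolding C_def by (intro add_nonneg_pos add_nonneg_nonneg mult_nonneg_nonneg) auto
    fix t assume "t \<in> {0..\<tau>}"
    then have t: "t \<in> {0..<T}"
      using sub by blast
    have "(u i has_real_derivative u' i t) (at t within {0..\<tau>})" for i
      using relaxation_schemeD(1)[OF sol t h_def] sub unfolding u'_def by (rule DERIV_subset)
    moreover have "(v i has_real_derivative v' i t) (at t within {0..\<tau>})" for i
      using relaxation_schemeD(2)[OF sol t h_def] sub unfolding v'_def by (rule DERIV_subset)
    ultimately show "(w k has_real_derivative w' k t) (at t within {0..\<tau>})" for k
      unfolding w_def w'_def by simp
    obtain M N where "\<forall>i. \<bar>u i t\<bar> \<le> M" "\<forall>i. \<bar>v i t\<bar> \<le> N"
      using far_field_pointwise_bounded[OF far(1) t] far_field_pointwise_bounded[OF far(2) t]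
      by blast
    then have "\<bar>w k t\<bar> \<le> max M N" for k
      unfolding w_def by (simp add: le_max_iff_disj)
    then show "\<exists>N. \<forall>k. \<bar>w k t\<bar> \<le> N"
      by blast
    fix k N assume wN: "\<bar>w k t\<bar> \<le> N" for k
    have uN: "\<bar>u j t\<bar> \<le> N" and vN: "\<bar>v j t\<bar> \<le> N" for j
      using wN[of "(True, j)"] wN[of "(False, j)"] unfolding w_def by simp_all
    have N0: "0 \<le> N"
      using uN[of 0] by linarith
    have second: "\<bar>lam * h * (u (j + 1) t - 2 * u j t + u (j - 1) t)\<bar> \<le> \<bar>lam * h\<bar> * (4 * N)"
        "\<bar>lam * h * (v (j + 1) t - 2 * v j t + v (j - 1) t)\<bar> \<le> \<bar>lam * h\<bar> * (4 * N)" for j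
      by (intro abs_mult_le abs_second_difference_le uN vN)+
    have first: "\<bar>- h * (v (j + 1) t - v (j - 1) t)\<bar> \<le> \<bar>- h\<bar> * (2 * N)" for j
      using vN[of "j + 1"] vN[of "j - 1"] by (intro abs_mult_le) linarith
    have first': "\<bar>lam^2 * h / eps^2 * (u (j + 1) t - u (j - 1) t)\<bar>
        \<le> \<bar>lam^2 * h / eps^2\<bar> * (2 * N)" for j
      using uN[of "j + 1"] uN[of "j - 1"] by (intro abs_mult_le) linarith
    have relax: "\<bar>1 / eps^2 * (a * u j t - v j t)\<bar> \<le> \<bar>1 / eps^2\<bar> * (\<bar>a\<bar> * N + N)" for j
      using abs_mult_le[OF uN[of j], of a] vN[of j] by (intro abs_mult_le) linarith
    define c1 c2 c3 c4 where c: "c1 = \<bar>h\<bar> * N" "c2 = \<bar>lam^2 * h / eps^2\<bar> * N"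
        "c3 = \<bar>lam * h\<bar> * N" "c4 = \<bar>1 / eps^2\<bar> * (\<bar>a\<bar> * N + N)"
    have c0: "0 \<le> c1" "0 \<le> c2" "0 \<le> c3" "0 \<le> c4"
      unfolding c using N0 by (simp_all add: zero_le_mult_iff)
    have CN: "C * N = c1 * 2 + c2 * 2 + c3 * 4 + c4 + N"
      unfolding C_def c by (simp add: algebra_simps)
    have "\<bar>u' j t\<bar> \<le> C * N" for j
    proof -
      have "\<bar>u' j t\<bar> \<le> 2 * c1 + 4 * c3"
        using first[of j] second(1)[of j] unfolding u'_def c by simp
      then show ?thesis
        unfolding CN using c0 N0 by linarith
    qed
    moreover have "\<bar>v' j t\<bar> \<le> C * N" for j
    proof -
      have "\<bar>v' j t\<bar> \<le> \<bar>lam^2 * h / eps^2\<bar> * (2 * N) + \<bar>lam * h\<bar> * (4 * N)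
          + \<bar>1 / eps^2\<bar> * (\<bar>a\<bar> * N + N)"
        using first'[of j] second(2)[of j] relax[of j] unfolding v'_def by linarith
      also have "\<dots> = 2 * c2 + 4 * c3 + c4"
        unfolding c by simp
      finally show ?thesis
        unfolding CN using c0 N0 by linarith
    qed
    ultimately show "\<bar>w' k t\<bar> \<le> C * N"
      unfolding w'_def by simp
  qed
  have "uniformly_bounded_family {0..\<tau>} (\<lambda>i. w (True, i))"
      "uniformly_bounded_family {0..\<tau>} (\<lambda>i. w (False, i))"
    by (rule uniformly_bounded_family_reindex[OF uniformly_bounded])+
  then show "uniformly_bounded_family {0..\<tau>} u" "uniformly_bounded_family {0..\<tau>} v"
    unfolding w_def by simp_all
qed

lemma limit_scheme_flux_has_derivative:
  assumes sol: "limit_scheme_solution lam a dx T ub vb" and t: "t \<in> {0..<T}"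
    and h: "h = 1 / (2 * dx)"
  shows "(vb i has_real_derivative
      - a * h * (vb (i + 1) t - vb (i - 1) t)
      + lam^2 * h^2 * (vb (i + 2) t - 2 * vb i t + vb (i - 2) t)
      + lam * h * (vb (i + 1) t - 2 * vb i t + vb (i - 1) t)) (at t within {0..<T})"
proof -
  define du where "du j = - h * (vb (j + 1) t - vb (j - 1) t)
    + lam * h * (ub (j + 1) t - 2 * ub j t + ub (j - 1) t)" for j
  have du: "(ub j has_real_derivative du j) (at t within {0..<T})" for j
    unfolding du_def by (rule limit_schemeD(1)[OF sol t h])
  have "((\<lambda>s. a * ub i s - lam^2 * h * (ub (i + 1) s - ub (i - 1) s)) has_real_derivative
      a * du i - lam^2 * h * (du (i + 1) - du (i - 1))) (at t within {0..<T})"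
    by (intro DERIV_diff DERIV_cmult du)
  moreover have "vb i s = a * ub i s - lam^2 * h * (ub (i + 1) s - ub (i - 1) s)"
    if "s \<in> {0..<T}" for s
    using limit_schemeD(2)[OF sol that h, of i] by simp
  ultimately have "(vb i has_real_derivative
      a * du i - lam^2 * h * (du (i + 1) - du (i - 1))) (at t within {0..<T})"
    unfolding has_field_derivative_def by (rule has_derivative_transform[OF t, rotated])
  also have "a * du i - lam^2 * h * (du (i + 1) - du (i - 1)) =
      - a * h * (vb (i + 1) t - vb (i - 1) t)
      + lam^2 * h^2 * (vb (i + 2) t - 2 * vb i t + vb (i - 2) t)
      + lam * h * (vb (i + 1) t - 2 * vb i t + vb (i - 1) t)"
    by (rule limit_scheme_flux_derivative[of lam h "\<lambda>j. ub j t" a "\<lambda>j. vb j t" du i])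
       (use limit_schemeD(2)[OF sol t h] in \<open>simp_all add: du_def\<close>)
  finally show ?thesis .
qed

section \<open>The relative entropy estimate\<close>

lemma phi_eq_infsum_entropy:
  "phi lam a eps dx ub vb u v t
    = (\<Sum>\<^sub>\<infinity>i. ereal (dx * entropy lam a eps (u i t - ub i t) (v i t - vb i t)))"
  unfolding phi_def entropy_def ..

lemma phi_nonneg:
  assumes "eps > 0" "lam > eps * \<bar>a\<bar>" "dx > 0"
  shows "0 \<le> phi lam a eps dx ub vb u v t"
  unfolding phi_eq_infsum_entropy using entropy_nonneg[OF assms(1,2)] assms(3)
  by (intro infsum_nonneg) simp

text \<open>
  The balance for the entropy of the errors, with the residual replaced by the time
  derivative \<open>D\<close> of \<open>vb\<close>.  The fluxes of both comparisons are added into one flux \<open>W\<close>.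
\<close>

lemma relative_entropy_estimate:
  assumes lam: "lam > 0" and K: "K > 0" and dx: "dx > 0" and eps: "eps > 0"
    and lim: "admissible_limit lam a dx T K ub vb um up vm vp"
    and rel: "admissible_relaxation lam a eps dx T ub vb um up vm vp u v"
    and tau: "\<tau> \<in> {0..<T}"
  shows "phi lam a eps dx ub vb u v \<tau> \<le> phi lam a eps dx ub vb u v 0 + ereal (K^2 / 4 * eps^4)"
proof -
  have limsol: "limit_scheme_solution lam a dx T ub vb"
    and norm: "L2Q_norm dx T (\<lambda>i. deriv (vb i)) \<le> ennreal K"
    and far_ub: "has_far_field T ub um up" and far_vb: "has_far_field T vb vm vp"
    using lim unfolding admissible_limit_def by auto
  have relsol: "relaxation_scheme_solution lam a eps dx T u v"
    and subchar: "lam > eps * \<bar>a\<bar>"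
    and far_u: "has_far_field T u um up" and far_v: "has_far_field T v vm vp"
    using rel unfolding admissible_relaxation_def by auto
  define h where "h = 1 / (2 * dx)"
  have h0: "0 \<le> h"
    unfolding h_def using dx by simp
  define S where "S = {0..\<tau>}"
  have S: "S \<subseteq> {0..<T}"
    unfolding S_def using tau by auto
  define p q where pq: "p = (\<lambda>i t. u i t - ub i t)" "q = (\<lambda>i t. v i t - vb i t)"
  define D where "D i t = - a * h * (vb (i + 1) t - vb (i - 1) t)
    + lam^2 * h^2 * (vb (i + 2) t - 2 * vb i t + vb (i - 2) t)
    + lam * h * (vb (i + 1) t - 2 * vb i t + vb (i - 1) t)" for i t
  define R where "R i t = lam * h * (vb (i + 1) t - 2 * vb i t + vb (i - 1) t) - D i t" for i t
  define p' where "p' i t = - h * (q (i + 1) t - q (i - 1) t)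
    + lam * h * (p (i + 1) t - 2 * p i t + p (i - 1) t)" for i t
  \<comment> \<open>In \<open>q'\<close> the second equation is kept for \<open>v\<close> itself, since \<open>vb\<close> satisfies a different one;
    the residual \<open>R\<close> appears when the constraint is used to rewrite it for \<open>q\<close>.\<close>
  define q' where "q' i t = - (lam^2 * h / eps^2 * (u (i + 1) t - u (i - 1) t))
    + lam * h * (v (i + 1) t - 2 * v i t + v (i - 1) t) + 1 / eps^2 * (a * u i t - v i t) - D i t"
    for i t
  have deriv_vb: "(vb i has_real_derivative D i t) (at t within {0..<T})" if "t \<in> {0..<T}" for i t
    unfolding D_def by (rule limit_scheme_flux_has_derivative[OF limsol that h_def])
  have deriv_p: "(p i has_real_derivative p' i t) (at t within S)" if t: "t \<in> S" for i t
  proof -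
    have T: "t \<in> {0..<T}"
      using t S by blast
    have "p' i t =
        (- h * (v (i + 1) t - v (i - 1) t) + lam * h * (u (i + 1) t - 2 * u i t + u (i - 1) t))
        - (- h * (vb (i + 1) t - vb (i - 1) t)
            + lam * h * (ub (i + 1) t - 2 * ub i t + ub (i - 1) t))"
      unfolding p'_def pq by (simp add: algebra_simps)
    then have "(p i has_real_derivative p' i t) (at t within {0..<T})"
      unfolding pq
      by (simp only:) (intro DERIV_diff relaxation_schemeD(1)[OF relsol T h_def]
            limit_schemeD(1)[OF limsol T h_def])
    then show ?thesis
      using S by (rule DERIV_subset)
  qed
  have deriv_q: "(q i has_real_derivative q' i t) (at t within S)" if t: "t \<in> S" for i t
  proof -
    have T: "t \<in> {0..<T}"
      using t S by blast
    have "(q i has_real_derivative q' i t) (at t within {0..<T})"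
      unfolding pq q'_def
      by (intro DERIV_diff relaxation_schemeD(2)[OF relsol T h_def] deriv_vb[OF T])
    then show ?thesis
      using S by (rule DERIV_subset)
  qed
  have cont_p: "continuous_on S (p i)" for i
    by (rule DERIV_continuous_on[OF deriv_p])
  have cont_q: "continuous_on S (q i)" for i
    by (rule DERIV_continuous_on[OF deriv_q])
  have cont_vb: "continuous_on S (vb i)" for i
    by (rule continuous_on_subset[OF DERIV_continuous_on[OF deriv_vb] S])
  have cont_D: "continuous_on S (D i)" for i
    unfolding D_def by (intro continuous_intros cont_vb)
  define e where "e i t = dx * entropy lam a eps (p i t) (q i t)" for i t
  define e' where "e' i t = dx * (lam^2 * p i t * p' i t + eps^2 * q i t * q' i t
      - eps^2 * a * (p' i t * q i t + p i t * q' i t))" for i t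
  define g where "g i t = eps^4 / 4 * (dx * (D i t)^2)" for i t
  \<comment> \<open>The shifts are written as sums so that limits and bounds of shifted families apply
    literally.\<close>
  define W where "W i t =
      dx * (entropy_flux h lam a eps (p (i + -1) t) (q (i + -1) t) (p i t) (q i t)
            + eps^4 / 4 * residual_flux h lam a (vb (i + -2) t) (vb (i + -1) t) (vb i t) (vb (i + 1) t))"
    for i t
  have "(\<Sum>\<^sub>\<infinity>i. ereal (e i \<tau>)) \<le> (\<Sum>\<^sub>\<infinity>i. ereal (e i 0)) + ereal (K^2 / 4 * eps^4)"
  proof (rule infsum_le_of_local_balance[where e' = e' and g = g and W = W], fold S_def)
    show "0 \<le> \<tau>"
      using tau by simp
    show "0 \<le> e i t" for i t
      unfolding e_def using dx entropy_nonneg[OF eps subchar] by simp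
    show "(e i has_real_derivative e' i t) (at t within S)" if "t \<in> S" for i t
      unfolding e_def e'_def
      by (intro DERIV_cmult entropy_has_derivative deriv_p[OF that] deriv_q[OF that])
    show "e' i t \<le> g i t + (W (i + 1) t - W i t)" if t: "t \<in> S" for i t
    proof -
      have T: "t \<in> {0..<T}"
        using t S by blast
      have idx: "i + 1 + - 1 = i" "i + 1 + - 2 = i - 1" "i + 1 + 1 = i + 2"
          "i + -1 = i - 1" "i + -2 = i - 2"
        by simp_all
      define \<Phi> where "\<Phi> = entropy_flux h lam a eps (p i t) (q i t) (p (i + 1) t) (q (i + 1) t)
          - entropy_flux h lam a eps (p (i - 1) t) (q (i - 1) t) (p i t) (q i t)"
      define \<Psi> where "\<Psi> = residual_flux h lam a (vb (i - 1) t) (vb i t) (vb (i + 1) t) (vb (i + 2) t)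
          - residual_flux h lam a (vb (i - 2) t) (vb (i - 1) t) (vb i t) (vb (i + 1) t)"
      have "eps^2 * q' i t = - (lam^2 * h * (u (i + 1) t - u (i - 1) t))
          + eps^2 * (lam * h * (v (i + 1) t - 2 * v i t + v (i - 1) t))
          + (a * u i t - v i t) - eps^2 * D i t"
        unfolding q'_def using eps by (simp add: distrib_left right_diff_distrib)
      also have "\<dots> = - (lam^2 * h * (p (i + 1) t - p (i - 1) t))
          + eps^2 * (lam * h * (q (i + 1) t - 2 * q i t + q (i - 1) t))
          + (a * p i t - q i t) + eps^2 * R i t"
        using limit_schemeD(2)[OF limsol T h_def, of i] unfolding R_def pq
        by (simp add: algebra_simps)
      finally have q'_eq: "eps^2 * q' i t = - (lam^2 * h * (p (i + 1) t - p (i - 1) t))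
          + eps^2 * (lam * h * (q (i + 1) t - 2 * q i t + q (i - 1) t))
          + (a * p i t - q i t) + eps^2 * R i t" .
      have "lam^2 * p i t * p' i t + eps^2 * q i t * q' i t
          - eps^2 * a * (p' i t * q i t + p i t * q' i t) \<le> eps^4 / 4 * (R i t)^2 + \<Phi>"
        unfolding \<Phi>_def by (rule entropy_production[OF eps subchar h0 p'_def q'_eq])
      moreover have "(R i t)^2 \<le> (D i t)^2 + \<Psi>"
        unfolding R_def \<Psi>_def using lam h0 by (intro residual_square_le D_def) simp_all
      then have "eps^4 / 4 * (R i t)^2 \<le> eps^4 / 4 * ((D i t)^2 + \<Psi>)"
        by (intro mult_left_mono) simp_all
      ultimately have "e' i t \<le> dx * (eps^4 / 4 * ((D i t)^2 + \<Psi>) + \<Phi>)"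
        unfolding e'_def using dx by (intro mult_left_mono) linarith+
      also have "\<dots> = g i t + (W (i + 1) t - W i t)"
        unfolding g_def W_def \<Phi>_def \<Psi>_def idx by (simp add: algebra_simps)
      finally show ?thesis .
    qed
    show "continuous_on S (g i)" for i
      unfolding g_def by (intro continuous_intros cont_D)
    show "continuous_on S (W i)" for i
      unfolding W_def entropy_flux_def entropy_def residual_flux_def
      by (intro continuous_intros cont_p cont_q cont_vb)
    show "uniformly_bounded_family S W"
    proof -
      have ub: "uniformly_bounded_family S ub"
        unfolding S_def using tau by (intro limit_scheme_uniformly_bounded[OF limsol far_ub]) simp
      have uv: "uniformly_bounded_family S u" "uniformly_bounded_family S v"
        unfolding S_def using tau
        by (intro relaxation_scheme_uniformly_bounded[OF relsol far_u far_v]; simp)+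
      have vb: "uniformly_bounded_family S vb"
      proof -
        have "uniformly_bounded_family S (\<lambda>i t. a * ub i t - lam^2 * h * (ub (i + 1) t - ub (i - 1) t))"
          by (intro uniformly_bounded_family_intros ub uniformly_bounded_family_reindex[OF ub])
        moreover have "vb i t = a * ub i t - lam^2 * h * (ub (i + 1) t - ub (i - 1) t)"
          if "t \<in> S" for i t
          using limit_schemeD(2)[OF limsol subsetD[OF S that] h_def, of i] by simp
        ultimately show ?thesis
          by (simp add: uniformly_bounded_family_def)
      qed
      have p: "uniformly_bounded_family S p" and q: "uniformly_bounded_family S q"
        unfolding pq by (intro uniformly_bounded_family_diff ub uv vb)+
      show ?thesis
        unfolding W_def entropy_flux_def entropy_def residual_flux_def
        by (intro uniformly_bounded_family_intros p q vb uniformly_bounded_family_reindex[OF p]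
            uniformly_bounded_family_reindex[OF q] uniformly_bounded_family_reindex[OF vb])
    qed
    have W_lim: "((\<lambda>i. W i t) \<longlongrightarrow> 0) F"
      if p: "\<And>k. ((\<lambda>i. p (i + k) t) \<longlongrightarrow> 0) F" and q: "\<And>k. ((\<lambda>i. q (i + k) t) \<longlongrightarrow> 0) F"
        and vb: "\<And>k. ((\<lambda>i. vb (i + k) t) \<longlongrightarrow> l) F" for F t l
    proof -
      have "((\<lambda>i. W i t) \<longlongrightarrow> dx * (0 + eps^4 / 4 * 0)) F"
        unfolding W_def using p[of 0] q[of 0] vb[of 0]
        by (intro tendsto_mult tendsto_add tendsto_const entropy_flux_tendsto_0
            residual_flux_tendsto_0[where l = l] p q vb) simp_all
      then show ?thesis
        by simp
    qed
    show "((\<lambda>i. W i t) \<longlongrightarrow> 0) at_top" if "t \<in> S" for t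
    proof -
      have T: "t \<in> {0..<T}"
        using that S by blast
      have "((\<lambda>i. p i t) \<longlongrightarrow> up - up) at_top" "((\<lambda>i. q i t) \<longlongrightarrow> vp - vp) at_top"
          "((\<lambda>i. vb i t) \<longlongrightarrow> vp) at_top"
        unfolding pq
        by (intro tendsto_diff far_field_limits(2)[OF far_u T] far_field_limits(2)[OF far_ub T]
            far_field_limits(2)[OF far_v T] far_field_limits(2)[OF far_vb T])+
      then show ?thesis
        by (intro W_lim[where l = vp] tendsto_int_shift(1)[where w = "\<lambda>i. p i t"]
            tendsto_int_shift(1)[where w = "\<lambda>i. q i t"]
            tendsto_int_shift(1)[where w = "\<lambda>i. vb i t"]) simp_all
    qed
    show "((\<lambda>i. W i t) \<longlongrightarrow> 0) at_bot" if "t \<in> S" for t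
    proof -
      have T: "t \<in> {0..<T}"
        using that S by blast
      have "((\<lambda>i. p i t) \<longlongrightarrow> um - um) at_bot" "((\<lambda>i. q i t) \<longlongrightarrow> vm - vm) at_bot"
          "((\<lambda>i. vb i t) \<longlongrightarrow> vm) at_bot"
        unfolding pq
        by (intro tendsto_diff far_field_limits(1)[OF far_u T] far_field_limits(1)[OF far_ub T]
            far_field_limits(1)[OF far_v T] far_field_limits(1)[OF far_vb T])+
      then show ?thesis
        by (intro W_lim[where l = vm] tendsto_int_shift(2)[where w = "\<lambda>i. p i t"]
            tendsto_int_shift(2)[where w = "\<lambda>i. q i t"]
            tendsto_int_shift(2)[where w = "\<lambda>i. vb i t"]) simp_all
    qed
    show "integral S (\<lambda>t. \<Sum>i\<in>{- int n..int n}. g i t) \<le> K^2 / 4 * eps^4" for n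
    proof -
      have deriv_eq: "D i s = deriv (vb i) s" if "0 < s" "s < \<tau>" for i s
      proof -
        have "s \<in> interior {0..<T}"
          by (rule interiorI[of "{0<..<T}"]) (use that tau in auto)
        moreover have "s \<in> {0..<T}"
          using that tau by simp
        ultimately have "(vb i has_real_derivative D i s) (at s)"
          using deriv_vb[of s i] by (simp only: at_within_interior)
        then show ?thesis
          by (rule DERIV_imp_deriv[symmetric])
      qed
      have "integral S (\<lambda>t. \<Sum>i\<in>{- int n..int n}. dx * (D i t)^2) \<le> K^2"
        unfolding S_def using K dx tau cont_D deriv_eq
        by (intro integral_partial_sum_le_L2Q_norm[OF norm]) (simp_all add: S_def)
      then have "eps^4 / 4 * integral S (\<lambda>t. \<Sum>i\<in>{- int n..int n}. dx * (D i t)^2)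
          \<le> eps^4 / 4 * K^2"
        by (intro mult_left_mono) simp_all
      then show ?thesis
        unfolding g_def sum_distrib_left[symmetric] integral_mult_right by (simp add: mult.commute)
    qed
  qed
  then show ?thesis
    unfolding phi_eq_infsum_entropy e_def pq .
qed

theorem theorem3p1:
  fixes lam K :: real
  assumes "lam > 0" and "K > 0"
  shows "\<exists>B>0. \<forall>(a::real) (dx::real) (T::real)
      (ub :: int \<Rightarrow> real \<Rightarrow> real) (vb :: int \<Rightarrow> real \<Rightarrow> real) um up vm vp.
    dx > 0 \<and> T > 0 \<and> admissible_limit lam a dx T K ub vb um up vm vp \<longrightarrow>
      (\<forall>(eps::real) (u :: int \<Rightarrow> real \<Rightarrow> real) (v :: int \<Rightarrow> real \<Rightarrow> real).
        eps > 0 \<and> admissible_relaxation lam a eps dx T ub vb um up vm vp u v \<longrightarrow>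
          (\<forall>t\<in>{0..<T}. phi lam a eps dx ub vb u v t
             \<le> phi lam a eps dx ub vb u v 0 + ereal (B * eps ^ 4))) \<and>
      (\<forall>(u :: real \<Rightarrow> int \<Rightarrow> real \<Rightarrow> real) (v :: real \<Rightarrow> int \<Rightarrow> real \<Rightarrow> real).
        (\<forall>\<^sub>F eps in at_right 0.
          admissible_relaxation lam a eps dx T ub vb um up vm vp (u eps) (v eps)) \<and>
        ((\<lambda>eps. phi lam a eps dx ub vb (u eps) (v eps) 0) \<longlongrightarrow> 0) (at_right 0) \<longrightarrow>
          ((\<lambda>eps. SUP t\<in>{0..<T}. phi lam a eps dx ub vb (u eps) (v eps) t) \<longlongrightarrow> 0) (at_right 0))"
proof (intro exI[of _ "K^2 / 4"] conjI allI impI ballI)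
  \<comment> \<open>\<open>K\<^sup>2\<close> bounds the squared norm of the residual, and \<open>1 / 4\<close> comes from Young's inequality.\<close>
  show "0 < K^2 / 4"
    using assms by simp
next
  fix a dx T ub vb um up vm vp eps u v t
  assume *: "0 < dx \<and> 0 < T \<and> admissible_limit lam a dx T K ub vb um up vm vp"
    "0 < eps \<and> admissible_relaxation lam a eps dx T ub vb um up vm vp u v" "t \<in> {0..<T}"
  show "phi lam a eps dx ub vb u v t \<le> phi lam a eps dx ub vb u v 0 + ereal (K^2 / 4 * eps ^ 4)"
    by (rule relative_entropy_estimate[where T = T and um = um and up = up and vm = vm and vp = vp])
       (use assms * in simp_all)
next
  fix a dx T ub vb um up vm vp u v
  assume lim: "0 < dx \<and> 0 < T \<and> admissible_limit lam a dx T K ub vb um up vm vp"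
    and rel: "(\<forall>\<^sub>F eps in at_right 0.
          admissible_relaxation lam a eps dx T ub vb um up vm vp (u eps) (v eps)) \<and>
        ((\<lambda>eps. phi lam a eps dx ub vb (u eps) (v eps) 0) \<longlongrightarrow> 0) (at_right 0)"
  define P where "P eps t = phi lam a eps dx ub vb (u eps) (v eps) t" for eps t
  have ev: "\<forall>\<^sub>F eps in at_right 0. 0 < eps \<and>
      admissible_relaxation lam a eps dx T ub vb um up vm vp (u eps) (v eps)"
    using rel eventually_at_right_less[of "0::real"] by (simp add: eventually_conj_iff)
  show "((\<lambda>eps. SUP t\<in>{0..<T}. phi lam a eps dx ub vb (u eps) (v eps) t) \<longlongrightarrow> 0) (at_right 0)"
    unfolding P_def[symmetric]
  proof (rule tendsto_sandwich[of "\<lambda>_. 0"])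
    show "\<forall>\<^sub>F eps in at_right 0. 0 \<le> (SUP t\<in>{0..<T}. P eps t)"
      using ev
    proof eventually_elim
      case (elim eps)
      then have "0 \<le> P eps 0"
        unfolding P_def using lim by (intro phi_nonneg) (auto simp: admissible_relaxation_def)
      then show ?case
        using lim by (intro SUP_upper2[of 0]) simp_all
    qed
    show "\<forall>\<^sub>F eps in at_right 0. (SUP t\<in>{0..<T}. P eps t) \<le> P eps 0 + ereal (K^2 / 4 * eps^4)"
      using ev
    proof eventually_elim
      case (elim eps)
      then show ?case
        unfolding P_def using assms lim
        by (intro SUP_least
            relative_entropy_estimate[where T = T and um = um and up = up and vm = vm and vp = vp])
           simp_all
    qed
    have "((\<lambda>eps::real. ereal (K^2 / 4 * eps^4)) \<longlongrightarrow> ereal (K^2 / 4 * 0^4)) (at_right 0)"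
      by (intro tendsto_intros)
    then have "((\<lambda>eps. P eps 0 + ereal (K^2 / 4 * eps^4)) \<longlongrightarrow> 0 + ereal (K^2 / 4 * 0^4)) (at_right 0)"
      using rel unfolding P_def by (intro tendsto_add_ereal_general) simp_all
    then show "((\<lambda>eps. P eps 0 + ereal (K^2 / 4 * eps^4)) \<longlongrightarrow> 0) (at_right 0)"
      by simp
  qed simp
qed

end
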